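(* Let $f\in C^{0}(\mathbb{R}^n\times\mathbb{R}^m;\mathbb{R}^n)$ give rise to the control system $\dot{x}=f(x,u)$. If this control system admits a smooth ($C^\infty$), convex control Lyapunov function (CLF) with respect to $0\in\mathbb{R}^n$, then $$\forall x\in\mathbb{R}^n\setminus\{0\}\ \ \exists u\in\mathbb{R}^m\ :\quad f(x,u)\neq\lambda x\quad\text{for all }\lambda\in\mathbb{R}_{\geq 0}.$$
   Context: A function $V\in C^{\infty}(\mathbb{R}^n;\mathbb{R}_{\geq 0})$ is a control Lyapunov function (CLF) for a control system $\dot x=f(x,u)$, $f\in C^0(\mathbb{R}^n\times\mathbb{R}^m;\mathbb{R}^n)$, with respect to $0$ if (a) $V(0)=0$ and $V(x)>0$ for all $x\neq 0$; (b) for every $x\in\mathbb{R}^n\setminus\{0\}$, $\inf_{u\in\mathbb{R}^m}\langle\nabla V(x),f(x,u)\rangle<0$; (c) $V(x)\to+\infty$ as $\|x\|\to+\infty$. *)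

theory Defs
  imports "HOL-Analysis.Analysis"
begin

text \<open>Class \<open>C\<^sup>k\<close> on the whole space. In finite dimension, continuity of every directional
  derivative is equivalent to continuity of the total derivative in operator norm, so iterating
  over directional derivatives gives the usual notion.\<close>

primrec C_k :: "nat \<Rightarrow> ('a::euclidean_space \<Rightarrow> real) \<Rightarrow> bool" where
  "C_k 0 g \<longleftrightarrow> continuous_on UNIV g"
| "C_k (Suc k) g \<longleftrightarrow> (\<forall>x. g differentiable (at x)) \<and>
     (\<forall>v. C_k k (\<lambda>x. frechet_derivative g (at x) v))"

definition smooth :: "('a::euclidean_space \<Rightarrow> real) \<Rightarrow> bool" where
  "smooth g \<longleftrightarrow> (\<forall>k. C_k k g)"

definition gradient :: "('a::euclidean_space \<Rightarrow> real) \<Rightarrow> 'a \<Rightarrow> 'a" where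
  "gradient g x = (THE D. GDERIV g x :> D)"

lemma GDERIV_gradient:
  fixes g :: "'a::euclidean_space \<Rightarrow> real"
  assumes "g differentiable (at x)"
  shows "GDERIV g x :> gradient g x"
  unfolding gradient_def
proof (rule theI')
  from assms obtain L where L: "(g has_derivative L) (at x)"
    by (auto simp: differentiable_def)
  then have lin: "linear L"
    by (rule has_derivative_linear)
  have adj: "L h = h \<bullet> adjoint L 1" for h
    by (simp only: adjoint_works[OF lin] inner_real_def mult_1_right)
  show "\<exists>!D. GDERIV g x :> D"
  proof
    have "L = (\<lambda>h. h \<bullet> adjoint L 1)"
      by (rule ext) (rule adj)
    with L show "GDERIV g x :> adjoint L 1"
      by (simp add: gderiv_def)
  next
    fix D assume "GDERIV g x :> D"
    then have "(g has_derivative (\<lambda>h. h \<bullet> D)) (at x)"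
      by (simp add: gderiv_def)
    then have "L = (\<lambda>h. h \<bullet> D)"
      by (rule has_derivative_unique[OF L])
    then have "\<forall>h. h \<bullet> D = h \<bullet> adjoint L 1"
      by (metis adj)
    then show "D = adjoint L 1"
      by (rule vector_eq_ldot[THEN iffD1])
  qed
qed

text \<open>The infimum over the controls may be \<open>-\<infinity>\<close>, in which case the decrease condition holds;
  it is therefore taken in the extended reals (on \<^typ>\<open>real\<close>, the infimum of a set that is not
  bounded below is unspecified).\<close>

definition control_Lyapunov_function ::
    "((real^'n) \<times> (real^'m) \<Rightarrow> real^'n) \<Rightarrow> (real^'n \<Rightarrow> real) \<Rightarrow> bool" where
  "control_Lyapunov_function f V \<longleftrightarrow>
     smooth V \<and> (\<forall>x. 0 \<le> V x) \<and>
     V 0 = 0 \<and> (\<forall>x. x \<noteq> 0 \<longrightarrow> 0 < V x) \<and>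
     (\<forall>x. x \<noteq> 0 \<longrightarrow> (INF u. ereal (gradient V x \<bullet> f (x, u))) < 0) \<and>
     filterlim V at_top at_infinity"

end

theory Submission
  imports Defs
begin

text \<open>A convex function lies above its tangent planes; comparing at the origin gives
  \<open>\<langle>\<nabla>V(x), x\<rangle> \<ge> V(x) - V(0) > 0\<close>. A control \<open>u\<close> with \<open>\<langle>\<nabla>V(x), f(x,u)\<rangle> < 0\<close> therefore
  cannot have \<open>f(x,u)\<close> on the ray through \<open>x\<close>.\<close>

lemma convex_on_above_tangent_plane:
  fixes V :: "'a::real_inner \<Rightarrow> real"
  assumes conv: "convex_on UNIV V" and D: "GDERIV V x :> D"
  shows "V x + (y - x) \<bullet> D \<le> V y"
proof -
  \<comment> \<open>Restricting \<open>V\<close> to the line through \<open>x\<close> and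
    \<open>y\<close> reduces the claim to one real variable: \<open>g 0 = V x\<close>,
    \<open>g 1 = V y\<close>, and the slope of \<open>g\<close> at 0 is the derivative of
    \<open>V\<close> at \<open>x\<close> along \<open>y - x\<close>.\<close>
  define g where "g = (\<lambda>t::real. V (x + t *\<^sub>R (y - x)))"
  have "convex_on UNIV g"
  proof (intro convex_onI)
    fix t a b :: real
    assume t: "0 < t" "t < 1"
    have "x + ((1 - t) * a + t * b) *\<^sub>R (y - x)
        = (1 - t) *\<^sub>R (x + a *\<^sub>R (y - x)) + t *\<^sub>R (x + b *\<^sub>R (y - x))"
      by (simp add: algebra_simps)
    then show "g ((1 - t) *\<^sub>R a + t *\<^sub>R b) \<le> (1 - t) * g a + t * g b"
      using convex_onD[OF conv, of t "x + a *\<^sub>R (y - x)" "x + b *\<^sub>R (y - x)"] t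
      by (simp add: g_def)
  qed simp
  moreover have "(g has_field_derivative (y - x) \<bullet> D) (at 0)"
  proof -
    have "((\<lambda>t::real. x + t *\<^sub>R (y - x)) has_derivative (\<lambda>t. t *\<^sub>R (y - x))) (at 0)"
      by (auto intro!: derivative_eq_intros)
    \<comment> \<open>The base point is written as the value of the line at parameter 0, the form in
      which the chain rule needs it.\<close>
    moreover have "(V has_derivative (\<lambda>h. h \<bullet> D)) (at (x + 0 *\<^sub>R (y - x)))"
      using D by (simp add: gderiv_def)
    ultimately have "(g has_derivative (\<lambda>t. (t *\<^sub>R (y - x)) \<bullet> D)) (at 0)"
      unfolding g_def by (rule has_derivative_compose)
    then show ?thesis
      by (simp add: has_field_derivative_def mult_commute_abs)
  qed
  ultimately have "((y - x) \<bullet> D) * (1 - 0) \<le> g 1 - g 0"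
    by (intro convex_on_imp_above_tangent[where A = UNIV]) auto
  then show ?thesis
    by (simp add: g_def)
qed

theorem mainTheorem3:
  fixes f :: "(real^'n) \<times> (real^'m) \<Rightarrow> real^'n"
  assumes "continuous_on UNIV f"
    and "\<exists>V. control_Lyapunov_function f V \<and> convex_on UNIV V"
  shows "\<forall>x. x \<noteq> 0 \<longrightarrow> (\<exists>u. \<forall>l::real. 0 \<le> l \<longrightarrow> f (x, u) \<noteq> l *\<^sub>R x)"
proof (intro allI impI)
  fix x :: "real^'n"
  assume x: "x \<noteq> 0"
  obtain V where V: "control_Lyapunov_function f V" and conv: "convex_on UNIV V"
    using assms(2) by blast
  \<comment> \<open>Order one of smoothness gives differentiability, so that
    \<open>gradient V x\<close> is a genuine gradient.\<close>
  have "C_k (Suc 0) V"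
    using V by (simp only: control_Lyapunov_function_def smooth_def)
  then have "V differentiable (at x)"
    by simp
  then have "V x + (0 - x) \<bullet> gradient V x \<le> V 0"
    by (intro convex_on_above_tangent_plane conv GDERIV_gradient)
  moreover have "V 0 = 0" "0 < V x"
    using V x by (simp_all add: control_Lyapunov_function_def)
  ultimately have pos: "0 < gradient V x \<bullet> x"
    by (simp add: inner_commute)
  have "(INF u. ereal (gradient V x \<bullet> f (x, u))) < 0"
    using V x by (simp add: control_Lyapunov_function_def)
  \<comment> \<open>An infimum strictly below 0 forces some value below 0, whether or not it is
    attained or finite.\<close>
  then obtain u where u: "gradient V x \<bullet> f (x, u) < 0"
    by (auto simp: INF_less_iff)
  \<comment> \<open>Otherwise the inner product with the gradient would be
    \<open>l * (gradient V x \<bullet> x)\<close>, which is nonnegative; \<open>l = 0\<close> is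
    covered because the inequality in \<open>u\<close> is strict.\<close>
  have "f (x, u) \<noteq> l *\<^sub>R x" if "0 \<le> l" for l
    using u pos that by (auto simp: mult_less_0_iff)
  then show "\<exists>u. \<forall>l::real. 0 \<le> l \<longrightarrow> f (x, u) \<noteq> l *\<^sub>R x"
    by blast
qed

end
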